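(* There is an absolute constant $\kappa>0$ such that the following holds. Let $p$ be a prime, let $G$ be a subgroup of $\mathbb{F}_p^*$, and let $g,h:G\to\mathbb{F}_p^*$ be arbitrary functions. Let $f(x,y)=g(x)(h(x)+y)$ for $(x,y)\in G\times\mathbb{F}_p^*$ and put $m=\mu(g)$. Then for any $A\subset G$ and $B,C\subset\mathbb{F}_p^*$, $$|f(A,B)|\,|B+C|\ge\kappa\min\left(\frac{p|B|}{m},\frac{|A||B|^2|C|}{pm^2}\right).$$
   Context: $\mathbb{F}_p$ is the field with $p$ elements and $\mathbb{F}_p^*=\mathbb{F}_p\setminus\{0\}$ its multiplicative group. For a function $\varphi:G\to\mathbb{F}_p$, $\mu(\varphi)=\max_{t\in\mathbb{F}_p}|\{x\in G:\varphi(x)=t\}|$. Further, $f(A,B)=\{f(a,b):(a,b)\in A\times B\}$ and $B+C=\{b+c: b\in B,\ c\in C\}$. *)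

theory Defs
  imports Complex_Main "HOL-Number_Theory.Residues" "HOL-Algebra.Multiplicative_Group"
    "HOL-Algebra.AbelCoset"
begin

text \<open>The field with \<open>p\<close> elements, realised on the carrier \<open>{0..p-1}\<close>; its multiplicative
  group is \<open>mult_of (Fp p)\<close> and \<open>B <+>\<^bsub>Fp p\<^esub> C\<close> is the sumset modulo \<open>p\<close>.\<close>

abbreviation Fp :: "nat \<Rightarrow> int ring"
  where "Fp p \<equiv> residue_ring (int p)"

definition max_fibre :: "nat \<Rightarrow> int set \<Rightarrow> (int \<Rightarrow> int) \<Rightarrow> nat"
  where "max_fibre p G \<phi> = Max ((\<lambda>t. card {x \<in> G. \<phi> x = t}) ` carrier (Fp p))"

end

theory Submission
  imports Defs "HOL-Analysis.Convex"
begin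

text \<open>
  The inequality is an incidence estimate over \<open>\<F>\<^sub>p\<close>. For \<open>(a, c) \<in> A \<times> C\<close> consider the line
  \<open>u = g(a) v + g(a) (h(a) - c)\<close> in the plane of points \<open>(u, v)\<close>. Since
  \<open>f(a, b) = g(a) ((b + c) + h(a) - c)\<close>, each such line contains the \<open>|B|\<close> points
  \<open>(f(a, b), b + c)\<close> of the grid \<open>P = f(A, B) \<times> (B + C)\<close>, so the \<open>|A||C|\<close> lines have at
  least \<open>|A||B||C|\<close> incidences with \<open>P\<close>. The slope of a line determines \<open>a\<close> up to at most \<open>m\<close>
  choices, and then the line and \<open>a\<close> determine \<open>c\<close>; hence no line is repeated more than \<open>m\<close> times.

  On the other hand, a random point lies on an average of \<open>|A||C|/p\<close> lines, and the deviation
  from this average is controlled by its second moment (\<open>variance_lines_through\<close>): two lines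
  that are not parallel meet exactly once, so they behave like independent events, distinct
  parallel lines never meet, and only coincident lines push the variance up. Cauchy--Schwarz turns this into the bound
  \<open>|P||I|/p + \<surd>(p m |P||I|)\<close> for the number of incidences with \<open>|I| = |A||C|\<close> lines
  (\<open>incidence_bound\<close>). Comparing it with \<open>|I||B|\<close>, either the first summand
  accounts for half of the incidences, which gives \<open>|P| \<ge> p|B|/2\<close>, or the second one does,
  which gives \<open>|P| \<ge> |A||B|\<^sup>2|C|/(4pm)\<close> (\<open>rich_points_lower_bound\<close>). Since
  \<open>m \<ge> 1\<close>, these two bounds dominate \<open>1/4\<close> of the two terms of the minimum.
\<close>

section \<open>Second moments of fibre sizes\<close>

lemma sum_card_fibres:
  assumes "finite I" "finite V" "\<phi> ` I \<subseteq> V"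
  shows "(\<Sum>u\<in>V. card {i \<in> I. \<phi> i = u}) = card I"
  using sum.group[OF assms, of "\<lambda>_. 1::nat"] by simp

text \<open>Both sides count the pairs of elements of \<open>I\<close> with the same value.\<close>

lemma sum_card_fibres_squared:
  assumes "finite I" "finite V" "\<phi> ` I \<subseteq> V"
  shows "(\<Sum>u\<in>V. (card {i \<in> I. \<phi> i = u})\<^sup>2) = (\<Sum>i\<in>I. card {j \<in> I. \<phi> j = \<phi> i})"
proof -
  have "(card {i \<in> I. \<phi> i = u})\<^sup>2 = (\<Sum>i | i \<in> I \<and> \<phi> i = u. card {j \<in> I. \<phi> j = \<phi> i})" for u
    by (simp add: power2_eq_square)
  then show ?thesis
    using sum.group[OF assms, of "\<lambda>i. card {j \<in> I. \<phi> j = \<phi> i}"] by simp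
qed

lemma sum_card_swap:
  assumes "finite V" "finite I"
  shows "(\<Sum>v\<in>V. card {i \<in> I. R v i}) = (\<Sum>i\<in>I. card {v \<in> V. R v i})"
  using sum.swap_restrict[OF assms, of "\<lambda>_ _. 1::nat" R] by simp

lemma sum_Times_columns:
  "(\<Sum>x\<in>V \<times> W. F x) = (\<Sum>w\<in>W. \<Sum>v\<in>V. F (v, w))"
  by (subst sum.swap) (simp add: sum.cartesian_product)

section \<open>Incidences between points and lines modulo a prime\<close>

text \<open>A family of lines is given by slopes \<open>s\<close> and intercepts \<open>t\<close>, indexed by a set that may list
  a line repeatedly, so that incidences are counted with multiplicity.\<close>

definition lines_through ::
  "nat \<Rightarrow> ('i \<Rightarrow> int) \<Rightarrow> ('i \<Rightarrow> int) \<Rightarrow> 'i set \<Rightarrow> int \<times> int \<Rightarrow> 'i set"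
  where "lines_through p s t I = (\<lambda>(u, v). {i \<in> I. (s i * v + t i) mod int p = u})"

lemma card_common_points_le:
  assumes p: "prime p"
  shows "card {v \<in> {0..<int p}. (a * v + b) mod int p = (a' * v + b') mod int p}
    \<le> 1 + (if [a = a'] (mod int p) \<and> [b = b'] (mod int p) then p else 0)"
    (is "card ?S \<le> _")
proof (cases "[a = a'] (mod int p)")
  case True
  show ?thesis
  proof (cases "[b = b'] (mod int p)")
    case b: True
    have "card ?S \<le> card {0..<int p}" by (intro card_mono) auto
    then show ?thesis using True b by simp
  next
    case False
    have "\<not> [a * v + b = a' * v + b'] (mod int p)" for v
    proof -
      have "[a * v = a' * v] (mod int p)" using True by (rule cong_scalar_right)
      then show ?thesis
        using False by (metis cong_add_lcancel cong_add_rcancel cong_trans cong_sym)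
    qed
    then have "?S = {}" by (auto simp: cong_def)
    then show ?thesis by (metis card.empty zero_le)
  qed
next
  case False
  have "v = w" if "v \<in> ?S" "w \<in> ?S" for v w
  proof -
    have "[a * v + b = a' * v + b'] (mod int p)" "[a * w + b = a' * w + b'] (mod int p)"
      using that by (auto simp: cong_def)
    then have "[(a * v + b) - (a * w + b) = (a' * v + b') - (a' * w + b')] (mod int p)"
      by (rule cong_diff)
    then have "int p dvd (a - a') * (v - w)"
      by (simp add: cong_iff_dvd_diff algebra_simps)
    moreover have "\<not> int p dvd a - a'" using False by (simp add: cong_iff_dvd_diff)
    ultimately have "[v = w] (mod int p)"
      using p by (simp add: cong_iff_dvd_diff prime_dvd_mult_iff)
    then show ?thesis using that by (auto intro: cong_less_imp_eq_int)
  qed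
  moreover have "finite ?S" by (rule finite_subset[of _ "{0..<int p}"]) auto
  ultimately have "card ?S \<le> Suc 0" using card_le_Suc0_iff_eq by blast
  then show ?thesis by linarith
qed

lemma sum_card_lines_through:
  assumes p: "prime p" and I: "finite I"
  shows "(\<Sum>x\<in>{0..<int p} \<times> {0..<int p}. card (lines_through p s t I x)) = p * card I"
proof -
  have "int p > 0" using p prime_gt_0_nat by simp
  then have "(\<Sum>u\<in>{0..<int p}. card {i \<in> I. (s i * v + t i) mod int p = u}) = card I" for v
    by (intro sum_card_fibres I) auto
  then have "(\<Sum>v\<in>{0..<int p}. \<Sum>u\<in>{0..<int p}. card (lines_through p s t I (u, v))) = p * card I"
    by (simp add: lines_through_def)
  then show ?thesis by (simp add: sum_Times_columns)
qed

text \<open>The sum counts triples of a pair of lines and a common point. A pair of distinct lines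
  has at most one common point, and the at most \<open>M|I|\<close> pairs of coincident lines have \<open>p\<close>.\<close>

lemma sum_card_lines_through_squared_le:
  assumes p: "prime p" and I: "finite I"
    and mult: "\<And>i. i \<in> I \<Longrightarrow> card {j \<in> I. [s j = s i] (mod int p) \<and> [t j = t i] (mod int p)} \<le> M"
  shows "(\<Sum>x\<in>{0..<int p} \<times> {0..<int p}. (card (lines_through p s t I x))\<^sup>2)
    \<le> (card I)\<^sup>2 + p * M * card I"
proof -
  let ?V = "{0..<int p}"
  let ?\<phi> = "\<lambda>v i. (s i * v + t i) mod int p"
  let ?same = "\<lambda>i j. [s j = s i] (mod int p) \<and> [t j = t i] (mod int p)"
  have p0: "int p > 0" using p prime_gt_0_nat by simp
  have "(\<Sum>x\<in>?V \<times> ?V. (card (lines_through p s t I x))\<^sup>2)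
      = (\<Sum>v\<in>?V. \<Sum>u\<in>?V. (card {i \<in> I. ?\<phi> v i = u})\<^sup>2)"
    by (simp add: sum_Times_columns lines_through_def)
  also have "\<dots> = (\<Sum>v\<in>?V. \<Sum>i\<in>I. card {j \<in> I. ?\<phi> v j = ?\<phi> v i})"
    by (intro sum.cong refl sum_card_fibres_squared I) (use p0 in auto)
  also have "\<dots> = (\<Sum>i\<in>I. \<Sum>v\<in>?V. card {j \<in> I. ?\<phi> v j = ?\<phi> v i})"
    by (rule sum.swap)
  also have "\<dots> = (\<Sum>i\<in>I. \<Sum>j\<in>I. card {v \<in> ?V. ?\<phi> v j = ?\<phi> v i})"
    by (intro sum.cong refl sum_card_swap I) auto
  also have "\<dots> \<le> (\<Sum>i\<in>I. \<Sum>j\<in>I. 1 + (if ?same i j then p else 0))"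
    by (intro sum_mono card_common_points_le p)
  also have "\<dots> = (\<Sum>i\<in>I. card I + p * card {j \<in> I. ?same i j})"
    using I by (simp add: sum_Suc sum.distrib sum.If_cases Int_def mult.commute)
  also have "\<dots> \<le> (\<Sum>i\<in>I. card I + p * M)"
    by (intro sum_mono add_left_mono mult_left_mono mult) auto
  also have "\<dots> = (card I)\<^sup>2 + p * M * card I"
    by (simp add: power2_eq_square algebra_simps)
  finally show ?thesis .
qed

text \<open>The term \<open>|I|\<^sup>2\<close> of the second moment is cancelled exactly by the square of the mean
  \<open>|I|/p\<close> summed over all \<open>p\<^sup>2\<close> points.\<close>

lemma variance_lines_through:
  assumes p: "prime p" and I: "finite I"
    and mult: "\<And>i. i \<in> I \<Longrightarrow> card {j \<in> I. [s j = s i] (mod int p) \<and> [t j = t i] (mod int p)} \<le> M"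
  shows "(\<Sum>x\<in>{0..<int p} \<times> {0..<int p}.
      (real (card (lines_through p s t I x)) - real (card I) / real p)\<^sup>2)
    \<le> real p * real M * real (card I)"
proof -
  let ?W = "{0..<int p} \<times> {0..<int p}"
  let ?r = "\<lambda>x. real (card (lines_through p s t I x))"
  define \<mu> where "\<mu> = real (card I) / real p"
  have p0: "real p > 0" using p prime_gt_0_nat by simp
  have first: "(\<Sum>x\<in>?W. ?r x) = real p * real (card I)"
    using sum_card_lines_through[OF p I, of s t] by (metis of_nat_mult of_nat_sum)
  have "real (\<Sum>x\<in>?W. (card (lines_through p s t I x))\<^sup>2)
      \<le> real ((card I)\<^sup>2 + p * M * card I)"
    using sum_card_lines_through_squared_le[OF p I, of s t M] mult by (intro of_nat_mono) blast
  then have second: "(\<Sum>x\<in>?W. (?r x)\<^sup>2) \<le> (real (card I))\<^sup>2 + real p * real M * real (card I)"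
    by simp
  have "(\<Sum>x\<in>?W. (?r x - \<mu>)\<^sup>2) = (\<Sum>x\<in>?W. (?r x)\<^sup>2 - 2 * \<mu> * ?r x + \<mu>\<^sup>2)"
    by (intro sum.cong) (auto simp: power2_diff)
  also have "\<dots> = (\<Sum>x\<in>?W. (?r x)\<^sup>2) - 2 * \<mu> * (\<Sum>x\<in>?W. ?r x) + (real p)\<^sup>2 * \<mu>\<^sup>2"
    by (simp add: sum.distrib sum_subtractf sum_distrib_left card_cartesian_product power2_eq_square)
  also have "\<dots> = (\<Sum>x\<in>?W. (?r x)\<^sup>2) - (real (card I))\<^sup>2"
    unfolding first \<mu>_def using p0 by (simp add: field_simps power2_eq_square)
  finally show ?thesis using second unfolding \<mu>_def by linarith
qed

text \<open>The main term is the count expected from a random set of points; the error term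
  is Cauchy--Schwarz applied to the variance.\<close>

lemma incidence_bound:
  assumes p: "prime p" and I: "finite I"
    and mult: "\<And>i. i \<in> I \<Longrightarrow> card {j \<in> I. [s j = s i] (mod int p) \<and> [t j = t i] (mod int p)} \<le> M"
    and P: "P \<subseteq> {0..<int p} \<times> {0..<int p}"
  shows "(\<Sum>x\<in>P. real (card (lines_through p s t I x)))
    \<le> real (card P) * real (card I) / real p
      + sqrt (real p * real M * real (card P) * real (card I))"
proof -
  let ?d = "\<lambda>x. real (card (lines_through p s t I x)) - real (card I) / real p"
  have "(\<Sum>x\<in>P. ?d x)\<^sup>2 \<le> real (card P) * (\<Sum>x\<in>P. (?d x)\<^sup>2)"
    by (metis mult.commute sum_squared_le_sum_of_squares)
  also have "\<dots> \<le> real (card P) * (\<Sum>x\<in>{0..<int p} \<times> {0..<int p}. (?d x)\<^sup>2)"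
    by (intro mult_left_mono sum_mono2 P) auto
  also have "\<dots> \<le> real (card P) * (real p * real M * real (card I))"
    by (intro mult_left_mono variance_lines_through p I mult) auto
  finally have "(\<Sum>x\<in>P. ?d x) \<le> sqrt (real p * real M * real (card P) * real (card I))"
    by (intro real_le_rsqrt) (simp add: mult_ac)
  then show ?thesis by (simp add: sum_subtractf)
qed

text \<open>Every line carries a share \<open>k\<close> of the incidences, so one of the two terms of the
  incidence bound is at least \<open>k/2\<close> per line.\<close>

lemma rich_points_lower_bound:
  assumes p: "prime p" and I: "finite I"
    and mult: "\<And>i. i \<in> I \<Longrightarrow> card {j \<in> I. [s j = s i] (mod int p) \<and> [t j = t i] (mod int p)} \<le> M"
    and P: "P \<subseteq> {0..<int p} \<times> {0..<int p}"
    and rich: "\<And>i. i \<in> I \<Longrightarrow> k \<le> card {x \<in> P. i \<in> lines_through p s t I x}"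
    and M: "M > 0" and ne: "I \<noteq> {}"
  shows "real p * real k / 2 \<le> real (card P)
    \<or> real (card I) * (real k)\<^sup>2 / (4 * real p * real M) \<le> real (card P)"
proof (subst disj_imp, rule impI)
  assume few: "\<not> real p * real k / 2 \<le> real (card P)"
  let ?n = "real (card I)"
  have p0: "real p > 0" using p prime_gt_0_nat by simp
  have n0: "?n > 0" using I ne by (simp add: card_gt_0_iff)
  have finP: "finite P" using P by (rule finite_subset) auto
  have "(\<Sum>i\<in>I. k) \<le> (\<Sum>i\<in>I. card {x \<in> P. i \<in> lines_through p s t I x})"
    by (intro sum_mono rich)
  also have "\<dots> = (\<Sum>x\<in>P. card {i \<in> I. i \<in> lines_through p s t I x})"
    by (rule sum_card_swap[OF I finP])
  also have "\<dots> = (\<Sum>x\<in>P. card (lines_through p s t I x))"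
    by (intro sum.cong refl arg_cong[of _ _ card]) (auto simp: lines_through_def)
  finally have "?n * real k \<le> (\<Sum>x\<in>P. real (card (lines_through p s t I x)))"
    by (simp flip: of_nat_mult of_nat_sum)
  also have "\<dots> \<le> real (card P) * ?n / real p + sqrt (real p * real M * real (card P) * ?n)"
    by (intro incidence_bound p I mult P)
  also have "real (card P) * ?n / real p \<le> ?n * real k / 2"
  proof -
    have "real (card P) * ?n \<le> (real p * real k / 2) * ?n"
      using few n0 by (intro mult_right_mono) auto
    then show ?thesis using p0 by (simp add: field_simps)
  qed
  finally have "?n * real k / 2 \<le> sqrt (real p * real M * real (card P) * ?n)" by simp
  then have "(?n * real k / 2)\<^sup>2 \<le> (sqrt (real p * real M * real (card P) * ?n))\<^sup>2"
    by (intro power_mono) auto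
  then have "?n * (?n * (real k)\<^sup>2) \<le> ?n * (4 * real p * real M * real (card P))"
    by (simp add: power2_eq_square field_simps)
  then have "?n * (real k)\<^sup>2 \<le> 4 * real p * real M * real (card P)"
    using n0 by simp
  then show "?n * (real k)\<^sup>2 / (4 * real p * real M) \<le> real (card P)"
    using p0 M by (simp add: field_simps)
qed

section \<open>The lines attached to the two-variable function\<close>

lemma card_fibre_le_max_fibre:
  assumes "t \<in> carrier (Fp p)"
  shows "card {x \<in> G. \<phi> x = t} \<le> max_fibre p G \<phi>"
  using assms unfolding max_fibre_def by (intro Max_ge) (auto simp: residue_ring_def)

text \<open>The slope confines \<open>a\<close> to a fibre of \<open>g\<close>, and for given \<open>a\<close> the intercept
  determines \<open>c\<close> because \<open>g(a) \<noteq> 0\<close>.\<close>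

lemma line_multiplicity_le:
  fixes g h :: "int \<Rightarrow> int"
  assumes p: "prime p" and A: "finite A"
    and g: "\<And>a. a \<in> A \<Longrightarrow> g a \<in> {0<..<int p}"
    and C: "C \<subseteq> {0..<int p}"
    and i: "i \<in> A \<times> C"
  shows "card {j \<in> A \<times> C. [g (fst j) = g (fst i)] (mod int p)
      \<and> [g (fst j) * (h (fst j) - snd j) = g (fst i) * (h (fst i) - snd i)] (mod int p)}
    \<le> card {a \<in> A. g a = g (fst i)}" (is "card ?J \<le> card ?K")
proof (rule card_inj_on_le[of fst])
  show "finite ?K" using A by simp
  show "fst ` ?J \<subseteq> ?K"
  proof (rule image_subsetI)
    fix j assume "j \<in> ?J"
    then have j: "fst j \<in> A" "[g (fst j) = g (fst i)] (mod int p)" by auto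
    have "g (fst j) = g (fst i)"
      using g[of "fst j"] g[of "fst i"] i j by (intro cong_less_imp_eq_int) auto
    then show "fst j \<in> ?K" using j by simp
  qed
  show "inj_on fst ?J"
  proof (rule inj_onI)
    fix j k assume jk: "j \<in> ?J" "k \<in> ?J" "fst j = fst k"
    define a where "a = fst j"
    have a: "fst j = a" "fst k = a" "a \<in> A" and c: "snd j \<in> C" "snd k \<in> C"
      using jk by (auto simp: a_def)
    have "[g a * (h a - snd j) = g a * (h a - snd k)] (mod int p)"
      using jk a by (auto simp: cong_def)
    then have "int p dvd g a * (snd k - snd j)"
      by (simp add: cong_iff_dvd_diff algebra_simps)
    moreover have "\<not> int p dvd g a"
      using g[OF a(3)] by (auto dest: zdvd_imp_le)
    ultimately have "[snd k = snd j] (mod int p)"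
      using p by (simp add: cong_iff_dvd_diff prime_dvd_mult_iff)
    then have "snd k = snd j"
      using c C by (intro cong_less_imp_eq_int) auto
    then show "j = k" using jk by (simp add: prod_eq_iff)
  qed
qed

text \<open>The points are \<open>(f(a, b), b + c)\<close>, which are distinct by their second coordinate.\<close>

lemma card_grid_points_on_line:
  fixes g h :: "int \<Rightarrow> int"
  assumes B: "finite B" "B \<subseteq> {0..<int p}"
    and PF: "finite F" "\<And>b. b \<in> B \<Longrightarrow> (g a * (h a + b)) mod int p \<in> F"
    and PS: "finite S" "\<And>b. b \<in> B \<Longrightarrow> (b + c) mod int p \<in> S"
    and i: "(a, c) \<in> I"
  shows "card B \<le> card {x \<in> F \<times> S. (a, c) \<in>
    lines_through p (\<lambda>i. g (fst i)) (\<lambda>i. g (fst i) * (h (fst i) - snd i)) I x}" (is "_ \<le> card ?K")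
proof (rule card_inj_on_le[of "\<lambda>b. ((g a * (h a + b)) mod int p, (b + c) mod int p)"])
  show "finite ?K" using PF PS by simp
  show "inj_on (\<lambda>b. ((g a * (h a + b)) mod int p, (b + c) mod int p)) B"
  proof (rule inj_onI)
    fix b b' assume b: "b \<in> B" "b' \<in> B"
      and "((g a * (h a + b)) mod int p, (b + c) mod int p)
        = ((g a * (h a + b')) mod int p, (b' + c) mod int p)"
    then have "[b + c = b' + c] (mod int p)" by (simp add: cong_def)
    then have "[b = b'] (mod int p)" by (simp add: cong_add_rcancel)
    then show "b = b'" using b B by (intro cong_less_imp_eq_int) auto
  qed
  have "(g a * ((b + c) mod int p) + g a * (h a - c)) mod int p = (g a * (h a + b)) mod int p" for b
  proof -
    have "(g a * ((b + c) mod int p) + g a * (h a - c)) mod int p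
        = (g a * (b + c) + g a * (h a - c)) mod int p"
      by (metis mod_add_left_eq mod_mult_right_eq)
    then show ?thesis by (simp add: algebra_simps)
  qed
  then show "(\<lambda>b. ((g a * (h a + b)) mod int p, (b + c) mod int p)) ` B \<subseteq> ?K"
    using PF PS i by (auto simp: lines_through_def)
qed

theorem theorem2p3:
  shows "\<exists>\<kappa>::real. \<kappa> > 0 \<and>
    (\<forall>(p::nat) (G::int set) (g::int \<Rightarrow> int) (h::int \<Rightarrow> int) (f::int \<Rightarrow> int \<Rightarrow> int) (m::nat)
        (A::int set) (B::int set) (C::int set).
      prime p \<longrightarrow>
      subgroup G (mult_of (Fp p)) \<longrightarrow>
      g \<in> G \<rightarrow> carrier (mult_of (Fp p)) \<longrightarrow>
      h \<in> G \<rightarrow> carrier (mult_of (Fp p)) \<longrightarrow>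
      (\<forall>x\<in>G. \<forall>y\<in>carrier (mult_of (Fp p)).
        f x y = g x \<otimes>\<^bsub>Fp p\<^esub> (h x \<oplus>\<^bsub>Fp p\<^esub> y)) \<longrightarrow>
      m = max_fibre p G g \<longrightarrow>
      A \<subseteq> G \<longrightarrow>
      B \<subseteq> carrier (mult_of (Fp p)) \<longrightarrow>
      C \<subseteq> carrier (mult_of (Fp p)) \<longrightarrow>
      real (card {f a b | a b. a \<in> A \<and> b \<in> B}) * real (card (B <+>\<^bsub>Fp p\<^esub> C))
        \<ge> \<kappa> * min (real p * real (card B) / real m)
                  (real (card A) * (real (card B))\<^sup>2 * real (card C) / (real p * (real m)\<^sup>2)))"
proof (rule exI[of _ "1/4"], intro conjI allI impI)
  show "(1/4 :: real) > 0" by simp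
next
  fix p :: nat and G :: "int set" and g h :: "int \<Rightarrow> int" and f :: "int \<Rightarrow> int \<Rightarrow> int"
    and m :: nat and A B C :: "int set"
  assume p: "prime p" and G: "subgroup G (mult_of (Fp p))"
    and g: "g \<in> G \<rightarrow> carrier (mult_of (Fp p))"
    and h: "h \<in> G \<rightarrow> carrier (mult_of (Fp p))"
    and f: "\<forall>x\<in>G. \<forall>y\<in>carrier (mult_of (Fp p)). f x y = g x \<otimes>\<^bsub>Fp p\<^esub> (h x \<oplus>\<^bsub>Fp p\<^esub> y)"
    and m: "m = max_fibre p G g"
    and A: "A \<subseteq> G" and B: "B \<subseteq> carrier (mult_of (Fp p))"
    and C: "C \<subseteq> carrier (mult_of (Fp p))"
  have p0: "p > 0" using p prime_gt_0_nat by simp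
  have units: "carrier (mult_of (Fp p)) = {0<..<int p}"
    by (auto simp: residue_ring_def)
  have finG: "finite G"
    using subgroup.subset[OF G] units finite_subset by fastforce
  have fin: "finite A" "finite B" "finite C"
    using A B C finG units finite_subset by (auto intro: finite_subset)
  define F where "F = {f a b | a b. a \<in> A \<and> b \<in> B}"
  define S where "S = B <+>\<^bsub>Fp p\<^esub> C"
  have F: "F = (\<lambda>(a, b). (g a * (h a + b)) mod int p) ` (A \<times> B)"
  proof -
    have "f a b = (g a * (h a + b)) mod int p" if "a \<in> A" "b \<in> B" for a b
      using f A B that by (auto simp: residue_ring_def mod_mult_right_eq)
    then show ?thesis by (force simp: F_def)
  qed
  have S: "S = (\<lambda>(b, c). (b + c) mod int p) ` (B \<times> C)"
    unfolding S_def set_add_def' by (auto simp: residue_ring_def)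
  let ?min = "min (real p * real (card B) / real m)
    (real (card A) * (real (card B))\<^sup>2 * real (card C) / (real p * (real m)\<^sup>2))"
  have "1/4 * ?min \<le> real (card F) * real (card S)"
  proof (cases "A = {} \<or> C = {}")
    case True
    then have "?min \<le> 0" by (auto simp: min_def)
    then show ?thesis
      by (meson mult_nonneg_nonpos mult_nonneg_nonneg of_nat_0_le_iff order_trans
          zero_le_divide_1_iff zero_le_numeral)
  next
    case False
    then obtain a where a: "a \<in> A" by blast
    have fibre: "card {x \<in> G. g x = g a} \<le> m" if "a \<in> A" for a
    proof -
      have "g a \<in> {0<..<int p}" using g A that units by blast
      then show ?thesis
        unfolding m by (intro card_fibre_le_max_fibre) (auto simp: residue_ring_def)
    qed
    have "card {x \<in> G. g x = g a} > 0" using a A finG by (auto simp: card_gt_0_iff)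
    then have m0: "m > 0" using fibre[OF a] by simp
    have mult: "card {j \<in> A \<times> C. [g (fst j) = g (fst i)] (mod int p)
        \<and> [g (fst j) * (h (fst j) - snd j) = g (fst i) * (h (fst i) - snd i)] (mod int p)} \<le> m"
      if i: "i \<in> A \<times> C" for i
    proof -
      have "card {a \<in> A. g a = g (fst i)} \<le> card {a \<in> G. g a = g (fst i)}"
        using A finG by (intro card_mono) auto
      also have "\<dots> \<le> m" using i by (intro fibre) auto
      finally have "card {a \<in> A. g a = g (fst i)} \<le> m" .
      moreover have "\<And>a. a \<in> A \<Longrightarrow> g a \<in> {0<..<int p}" "C \<subseteq> {0..<int p}"
        using g A C units by auto
      ultimately show ?thesis
        using line_multiplicity_le[OF p fin(1) _ _ i, of g h] by (meson order_trans)
    qed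
    have "real p * real (card B) / 2 \<le> real (card (F \<times> S))
      \<or> real (card (A \<times> C)) * (real (card B))\<^sup>2 / (4 * real p * real m) \<le> real (card (F \<times> S))"
    proof (rule rich_points_lower_bound[OF p _ mult])
      show "finite (A \<times> C)" "A \<times> C \<noteq> {}" using fin False by auto
      show "F \<times> S \<subseteq> {0..<int p} \<times> {0..<int p}" using p0 by (auto simp: F S)
      show "card B \<le> card {x \<in> F \<times> S. i \<in> lines_through p (\<lambda>i. g (fst i))
          (\<lambda>i. g (fst i) * (h (fst i) - snd i)) (A \<times> C) x}" if ac: "i \<in> A \<times> C" for i
      proof -
        obtain a c where i: "i = (a, c)" "a \<in> A" "c \<in> C" using ac by auto
        show ?thesis unfolding i(1)
          by (rule card_grid_points_on_line) (use fin B units i in \<open>auto simp: F S\<close>)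
      qed
    qed (use m0 in auto)
    then have "real p * real (card B) / 2 \<le> real (card F) * real (card S)
      \<or> real (card A) * (real (card B))\<^sup>2 * real (card C) / (4 * real p * real m)
        \<le> real (card F) * real (card S)"
      by (simp add: card_cartesian_product mult_ac)
    then show ?thesis
    proof
      assume *: "real p * real (card B) / 2 \<le> real (card F) * real (card S)"
      have "1/4 * ?min \<le> 1/4 * (real p * real (card B) / real m)" by simp
      also have "\<dots> \<le> 1/4 * (real p * real (card B) / 1)"
        using m0 by (intro mult_left_mono divide_left_mono) auto
      also have "\<dots> \<le> real p * real (card B) / 2" by simp
      finally show ?thesis using * by linarith
    next
      let ?N = "real (card A) * (real (card B))\<^sup>2 * real (card C)"
      assume *: "?N / (4 * real p * real m) \<le> real (card F) * real (card S)"
      have "1/4 * ?min \<le> ?N / (4 * real p * (real m)\<^sup>2)" by simp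
      also have "\<dots> \<le> ?N / (4 * real p * real m)"
        using m0 p0 by (intro divide_left_mono) (auto simp: power2_eq_square)
      finally show ?thesis using * by linarith
    qed
  qed
  then show "1/4 * ?min \<le> real (card {f a b | a b. a \<in> A \<and> b \<in> B})
      * real (card (B <+>\<^bsub>Fp p\<^esub> C))"
    by (simp add: F_def S_def)
qed

end
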